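(* Let $(X,\pi;M_X,I_X)$ and $(Y,\sigma;M_Y,I_Y)$ be impulsive semidynamical systems satisfying the standing assumptions. Let $x\in X$ be asymptotically almost $\tilde\pi$-periodic and let $y\in Y$. The point $y$ is comparable in limit with $x$ if and only if there is a continuous mapping $h:\tilde L_X^+(x)\to\tilde L_Y^+(y)$ satisfying the conditions: (a) $\mathcal L_{x,q}^{+\infty}\subset\mathcal L_{y,h(q)}^{+\infty}$ for all $q\in\tilde L_X^+(x)$; (b) $h(\tilde\pi(q,t))=\tilde\sigma(h(q),t)$ for all $q\in\tilde L_X^+(x)\setminus M_X$ and $t\in\mathbb R_+$; (c) for $\tilde q\in\mathcal P_x\setminus M_X$ and $\{t_n\}_{n\in\mathbb N}\in\mathcal L_x^{+\infty}$ we have $$\lim_{n\to+\infty}\rho_Y\big(\tilde\sigma(y,t_n),\tilde\sigma(h(\tilde q),g_{\tilde q}^x(t_n))\big)=0.$$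
   Context: Let $\mathbb R_+=[0,+\infty)$. A semidynamical system $(Z,\varrho)$ on a metric space $Z$ is a continuous map $\varrho:Z\times\mathbb R_+\to Z$ with $\varrho(z,0)=z$ and $\varrho(\varrho(z,t),s)=\varrho(z,t+s)$ for all $z\in Z$, $t,s\in\mathbb R_+$. For $z\in Z$, $t\ge 0$ put $F(z,t)=\{w\in Z:\varrho(w,t)=z\}$; for $D\subset Z$, $\Delta\subset[0,+\infty)$ put $F(D,\Delta)=\bigcup_{z\in D,\,t\in\Delta}F(z,t)$ (singletons are written without braces). A point $z$ is an initial point if $F(z,t)=\emptyset$ for all $t>0$. An impulsive semidynamical system (ISS) $(Z,\varrho;M,I)$ consists of a semidynamical system $(Z,\varrho)$, a nonempty closed set $M\subset Z$ such that for every $z\in M$ there is $\epsilon_z>0$ with $F(z,(0,\epsilon_z))\cap M=\emptyset$ and $\varrho(z,(0,\epsilon_z))\cap M=\emptyset$, and a continuous function $I:M\to Z$. Let $\phi(z)\in(0,+\infty]$ be the least $s>0$ with $\varrho(z,s)\in M$, and $\phi(z)=+\infty$ if no such $s$ exists. The impulsive trajectory $\tilde\varrho(z,\cdot)$ of $z$ is defined inductively: $z_0^+=z$, $t_0=0$; given $z_n^+$ and $t_n$, if $\phi(z_n^+)=+\infty$ then $\tilde\varrho(z,t)=\varrho(z_n^+,t-t_n)$ for all $t\ge t_n$; otherwise let $s_n=\phi(z_n^+)$, $t_{n+1}=t_n+s_n$, $\tilde\varrho(z,t)=\varrho(z_n^+,t-t_n)$ for $t_n\le t<t_{n+1}$,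 $z_{n+1}=\varrho(z_n^+,s_n)\in M$, $z_{n+1}^+=I(z_{n+1})$, and $\tilde\varrho(z,t_{n+1})=z_{n+1}^+$. Strong Tube Condition (STC): a point $z\in M$ satisfies STC if there are $\lambda>0$ and closed sets $S,L\subset Z$ with $z\in S$ such that $F(L,\lambda)=S$; $F(L,[0,2\lambda])$ is a neighborhood of $z$; $F(L,\mu)\cap F(L,\nu)=\emptyset$ for $0\le\mu<\nu\le 2\lambda$; and $S=M\cap F(L,[0,2\lambda])$. Standing assumptions on every ISS: no initial point of $(Z,\varrho)$ belongs to $M$ and every element of $M$ satisfies STC (consequently $\phi$ is continuous on $Z\setminus M$); $M\cap I(M)=\emptyset$; and $\tilde\varrho(z,t)$ is defined for all $t\ge 0$ and all $z\in Z$. Here $(X,\rho_X)$ and $(Y,\rho_Y)$ are metric spaces, and $\tilde\pi,\tilde\sigma$ denote the impulsive trajectories in $(X,\pi;M_X,I_X)$ and $(Y,\sigma;M_Y,I_Y)$. The positive limit set $\tilde L_X^+(x)$ is the set of all $q\in X$ for which there is a sequence $\lambda_n\to+\infty$ in $\mathbb R_+$ with $\tilde\pi(x,\lambda_n)\to q$; $\tilde L_Y^+(y)$ is defined analogously with $\tilde\sigma$. A point $p\in X$ is almost $\tilde\pi$-periodic if for every $\epsilon>0$ there is $T=T(\epsilon)>0$ such that for every $\alpha\ge0$ the interval $[\alpha,\alpha+T]$ contains a number $\tau_\alpha>0$ with $\rho_X(\tilde\pi(p,t+\tau_\alpha),\tilde\pi(p,t))<\epsilon$ for all $t\ge0$.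 A time reparametrization is a homeomorphism $g:\mathbb R_+\to\mathbb R_+$ with $g(0)=0$. A point $x\in X$ is asymptotically almost $\tilde\pi$-periodic if there are an almost $\tilde\pi$-periodic point $p\in X$ and a time reparametrization $g_p$ with $\lim_{t\to+\infty}\rho_X(\tilde\pi(x,t),\tilde\pi(p,g_p(t)))=0$. $\mathcal P_x$ is the set of all $z\in\tilde L_X^+(x)\cap\tilde L_X^+(z)$ for which there is a time reparametrization $g_z$ with $\lim_{t\to+\infty}\rho_X(\tilde\pi(x,t),\tilde\pi(z,g_z(t)))=0$. For each $z\in\mathcal P_x$, $g_z^x$ denotes such a time reparametrization (fixed, arbitrarily chosen). For a system $(Z,\varrho;M,I)$ and $z,p\in Z$: $\mathcal L_{z,p}^{+\infty}$ is the set of sequences $\{t_n\}_{n\in\mathbb N}\subset\mathbb R_+$ with $t_n\to+\infty$ and $\tilde\varrho(z,t_n)\to p$; $\mathcal L_z^{+\infty}=\bigcup_{p\in Z}\mathcal L_{z,p}^{+\infty}$. A point $y\in Y$ is comparable in limit with $x\in X$ if $\mathcal L_x^{+\infty}\subset\mathcal L_y^{+\infty}$. *)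

theory Defs
  imports "HOL-Analysis.Analysis"
begin

text \<open>
  Maps on \<open>Z \<times> [0,\<infinity>)\<close> are rendered as curried functions on \<open>'a \<Rightarrow> real\<close>; their values
  at negative times are irrelevant, and every time below is restricted to be nonnegative.
\<close>

locale semidynamical_system =
  fixes \<rho> :: "'a::metric_space \<Rightarrow> real \<Rightarrow> 'a"
  assumes flow_continuous: "continuous_on (UNIV \<times> {0..}) (\<lambda>(z, t). \<rho> z t)"
    and flow_zero: "\<rho> z 0 = z"
    and flow_add: "t \<ge> 0 \<Longrightarrow> s \<ge> 0 \<Longrightarrow> \<rho> (\<rho> z t) s = \<rho> z (t + s)"

definition pre_flow :: "('a \<Rightarrow> real \<Rightarrow> 'a) \<Rightarrow> 'a set \<Rightarrow> real set \<Rightarrow> 'a set" where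
  "pre_flow \<rho> D \<Delta> = (\<Union>z\<in>D. \<Union>t\<in>\<Delta>. {w. \<rho> w t = z})"

definition initial_point :: "('a \<Rightarrow> real \<Rightarrow> 'a) \<Rightarrow> 'a \<Rightarrow> bool" where
  "initial_point \<rho> z \<longleftrightarrow> (\<forall>t>0. pre_flow \<rho> {z} {t} = {})"

locale impulsive_system = semidynamical_system \<rho>
  for \<rho> :: "'a::metric_space \<Rightarrow> real \<Rightarrow> 'a" +
  fixes M :: "'a set" and I :: "'a \<Rightarrow> 'a"
  assumes impulsive_set_nonempty: "M \<noteq> {}"
    and impulsive_set_closed: "closed M"
    and impulsive_set_isolated:
      "z \<in> M \<Longrightarrow> \<exists>\<epsilon>>0. pre_flow \<rho> {z} {0<..<\<epsilon>} \<inter> M = {} \<and> \<rho> z ` {0<..<\<epsilon>} \<inter> M = {}"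
    and impulse_continuous: "continuous_on M I"

definition hit_time :: "('a \<Rightarrow> real \<Rightarrow> 'a) \<Rightarrow> 'a set \<Rightarrow> 'a \<Rightarrow> ereal" where
  "hit_time \<rho> M z =
     (if \<exists>s>0. \<rho> z s \<in> M then ereal (LEAST s. s > 0 \<and> \<rho> z s \<in> M) else \<infinity>)"

text \<open>
  The post-impulse points \<open>z\<^sub>n\<^sup>+\<close> and the impulse times \<open>t\<^sub>n\<close>. If \<open>\<phi>(z\<^sub>n\<^sup>+) = \<infinity>\<close>, the
  construction stops: then \<open>t\<^sub>m = \<infinity>\<close> for all \<open>m > n\<close>, and the points with index \<open>m > n\<close> are
  meaningless and never used.
\<close>

primrec imp_point :: "('a \<Rightarrow> real \<Rightarrow> 'a) \<Rightarrow> 'a set \<Rightarrow> ('a \<Rightarrow> 'a) \<Rightarrow> 'a \<Rightarrow> nat \<Rightarrow> 'a" where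
  "imp_point \<rho> M I z 0 = z"
| "imp_point \<rho> M I z (Suc n) =
     (let w = imp_point \<rho> M I z n in I (\<rho> w (real_of_ereal (hit_time \<rho> M w))))"

primrec imp_time :: "('a \<Rightarrow> real \<Rightarrow> 'a) \<Rightarrow> 'a set \<Rightarrow> ('a \<Rightarrow> 'a) \<Rightarrow> 'a \<Rightarrow> nat \<Rightarrow> ereal" where
  "imp_time \<rho> M I z 0 = 0"
| "imp_time \<rho> M I z (Suc n) = imp_time \<rho> M I z n + hit_time \<rho> M (imp_point \<rho> M I z n)"

definition imp_stage ::
    "('a \<Rightarrow> real \<Rightarrow> 'a) \<Rightarrow> 'a set \<Rightarrow> ('a \<Rightarrow> 'a) \<Rightarrow> 'a \<Rightarrow> real \<Rightarrow> nat \<Rightarrow> bool" where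
  "imp_stage \<rho> M I z t n \<longleftrightarrow> imp_time \<rho> M I z n \<le> ereal t \<and> ereal t < imp_time \<rho> M I z (Suc n)"

text \<open>
  The impulsive trajectory is defined at time \<open>t\<close> iff some stage \<open>n\<close> contains \<open>t\<close>; the
  stage is then unique, since hitting times are positive.
\<close>

definition imp_traj_defined ::
    "('a \<Rightarrow> real \<Rightarrow> 'a) \<Rightarrow> 'a set \<Rightarrow> ('a \<Rightarrow> 'a) \<Rightarrow> 'a \<Rightarrow> real \<Rightarrow> bool" where
  "imp_traj_defined \<rho> M I z t \<longleftrightarrow> (\<exists>n. imp_stage \<rho> M I z t n)"

definition imp_traj ::
    "('a \<Rightarrow> real \<Rightarrow> 'a) \<Rightarrow> 'a set \<Rightarrow> ('a \<Rightarrow> 'a) \<Rightarrow> 'a \<Rightarrow> real \<Rightarrow> 'a" where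
  "imp_traj \<rho> M I z t =
     (let n = (THE n. imp_stage \<rho> M I z t n)
      in \<rho> (imp_point \<rho> M I z n) (t - real_of_ereal (imp_time \<rho> M I z n)))"

definition strong_tube_condition ::
    "('a::metric_space \<Rightarrow> real \<Rightarrow> 'a) \<Rightarrow> 'a set \<Rightarrow> 'a \<Rightarrow> bool" where
  "strong_tube_condition \<rho> M z \<longleftrightarrow>
     (\<exists>l>0. \<exists>S L. closed S \<and> closed L \<and> z \<in> S \<and>
        pre_flow \<rho> L {l} = S \<and>
        z \<in> interior (pre_flow \<rho> L {0..2 * l}) \<and>
        (\<forall>\<mu> \<nu>. 0 \<le> \<mu> \<and> \<mu> < \<nu> \<and> \<nu> \<le> 2 * l \<longrightarrow> pre_flow \<rho> L {\<mu>} \<inter> pre_flow \<rho> L {\<nu>} = {}) \<and>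
        S = M \<inter> pre_flow \<rho> L {0..2 * l})"

locale standing_impulsive_system = impulsive_system \<rho> M I
  for \<rho> :: "'a::metric_space \<Rightarrow> real \<Rightarrow> 'a" and M :: "'a set" and I :: "'a \<Rightarrow> 'a" +
  assumes no_initial_point: "z \<in> M \<Longrightarrow> \<not> initial_point \<rho> z"
    and stc: "z \<in> M \<Longrightarrow> strong_tube_condition \<rho> M z"
    and impulse_leaves: "M \<inter> I ` M = {}"
    and traj_defined: "t \<ge> 0 \<Longrightarrow> imp_traj_defined \<rho> M I z t"

text \<open>
  The notions below depend on a system only through its impulsive trajectories, so they are
  stated for an arbitrary map \<open>\<tau>\<close>, to be instantiated with \<open>imp_traj \<rho> M I\<close>.
\<close>

definition lim_seqs_at :: "('a::metric_space \<Rightarrow> real \<Rightarrow> 'a) \<Rightarrow> 'a \<Rightarrow> 'a \<Rightarrow> (nat \<Rightarrow> real) set" where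
  "lim_seqs_at \<tau> z p =
     {t. (\<forall>n. t n \<ge> 0) \<and> filterlim t at_top sequentially \<and> (\<lambda>n. \<tau> z (t n)) \<longlonglongrightarrow> p}"

definition lim_seqs :: "('a::metric_space \<Rightarrow> real \<Rightarrow> 'a) \<Rightarrow> 'a \<Rightarrow> (nat \<Rightarrow> real) set" where
  "lim_seqs \<tau> z = (\<Union>p. lim_seqs_at \<tau> z p)"

definition pos_limit_set :: "('a::metric_space \<Rightarrow> real \<Rightarrow> 'a) \<Rightarrow> 'a \<Rightarrow> 'a set" where
  "pos_limit_set \<tau> z = {q. \<exists>t. t \<in> lim_seqs_at \<tau> z q}"

definition comparable_in_limit ::
    "('b::metric_space \<Rightarrow> real \<Rightarrow> 'b) \<Rightarrow> 'b \<Rightarrow> ('a::metric_space \<Rightarrow> real \<Rightarrow> 'a) \<Rightarrow> 'a \<Rightarrow> bool" where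
  "comparable_in_limit \<tau>Y y \<tau>X x \<longleftrightarrow> lim_seqs \<tau>X x \<subseteq> lim_seqs \<tau>Y y"

definition almost_periodic :: "('a::metric_space \<Rightarrow> real \<Rightarrow> 'a) \<Rightarrow> 'a \<Rightarrow> bool" where
  "almost_periodic \<tau> p \<longleftrightarrow>
     (\<forall>\<epsilon>>0. \<exists>T>0. \<forall>\<alpha>\<ge>0. \<exists>s\<in>{\<alpha>..\<alpha> + T}. s > 0 \<and>
        (\<forall>t\<ge>0. dist (\<tau> p (t + s)) (\<tau> p t) < \<epsilon>))"

definition time_reparametrization :: "(real \<Rightarrow> real) \<Rightarrow> bool" where
  "time_reparametrization g \<longleftrightarrow> (\<exists>g'. homeomorphism {0..} {0..} g g') \<and> g 0 = 0"

definition asymptotic_reparam ::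
    "('a::metric_space \<Rightarrow> real \<Rightarrow> 'a) \<Rightarrow> 'a \<Rightarrow> 'a \<Rightarrow> (real \<Rightarrow> real) \<Rightarrow> bool" where
  "asymptotic_reparam \<tau> x z g \<longleftrightarrow>
     time_reparametrization g \<and> ((\<lambda>t. dist (\<tau> x t) (\<tau> z (g t))) \<longlongrightarrow> 0) at_top"

definition asymptotically_almost_periodic :: "('a::metric_space \<Rightarrow> real \<Rightarrow> 'a) \<Rightarrow> 'a \<Rightarrow> bool" where
  "asymptotically_almost_periodic \<tau> x \<longleftrightarrow>
     (\<exists>p g. almost_periodic \<tau> p \<and> asymptotic_reparam \<tau> x p g)"

definition reparam_points :: "('a::metric_space \<Rightarrow> real \<Rightarrow> 'a) \<Rightarrow> 'a \<Rightarrow> 'a set" where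
  "reparam_points \<tau> x =
     {z \<in> pos_limit_set \<tau> x \<inter> pos_limit_set \<tau> z. \<exists>g. asymptotic_reparam \<tau> x z g}"

end

(*
  The map h sends q to the common limit of y along all time sequences t_n for which x converges
  to q; interleaving two such sequences shows that the limit does not depend on the choice.

  By the tube condition, hitting times are continuous along a convergent sequence on which they
  stay bounded away from 0. Hence, if w_n converges to w in this way, there are delays e_n -> 0 such
  that the impulsive trajectories satisfy w_n(s_n) -> w(t) whenever s_n -> t and s_n >= t + e_n:
  waiting a little longer puts w_n past its k-th impulse as soon as w is. Using one common s_n for both systems gives (b).

  The point h(q) may lie on the impulsive set of Y even if q does not lie on that of X. If the
  hitting times along y tended to 0 there, they would be vanishing delays: they do not change the
  limit q of x, hence not the limit h(q) of y, but they move y to the image of h(q) under the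
  impulse, which is off the impulsive set.

  Condition (c) follows from (b) and the continuity of h.
*)

theory Submission
  imports Defs
begin

section \<open>Subsequences and limits in metric spaces\<close>

lemma frequently_subseq:
  assumes "\<exists>\<^sub>F n in sequentially. P n"
  obtains r :: "nat \<Rightarrow> nat" where "strict_mono r" "\<And>n. P (r n)"
proof -
  have "infinite {n. P n}"
    using assms by (auto simp: infinite_nat_iff_unbounded_le frequently_sequentially)
  then show ?thesis using infinite_enumerate[of "{n. P n}"] that by blast
qed

text \<open>If convergence failed, some subsequence would stay in \<open>K\<close> and outside a
  neighbourhood of \<open>x\<close>; compactness gives it a convergent further subsequence, whose
  limit must be \<open>x\<close>.\<close>

lemma tendsto_compact_unique_limit:
  fixes \<theta> :: "nat \<Rightarrow> 'a::metric_space"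
  assumes "compact K" and "\<forall>\<^sub>F n in sequentially. \<theta> n \<in> K"
    and "\<And>r l. strict_mono r \<Longrightarrow> (\<lambda>n. \<theta> (r n)) \<longlonglongrightarrow> l \<Longrightarrow> (\<And>n. \<theta> (r n) \<in> K) \<Longrightarrow> l \<in> K \<Longrightarrow> l = x"
  shows "\<theta> \<longlonglongrightarrow> x"
proof (rule topological_tendstoI, rule ccontr)
  fix S assume S: "open S" "x \<in> S" and "\<not> (\<forall>\<^sub>F n in sequentially. \<theta> n \<in> S)"
  then have "\<exists>\<^sub>F n in sequentially. \<theta> n \<notin> S \<and> \<theta> n \<in> K"
    using assms(2) by (auto intro: frequently_eventually_frequently simp: not_eventually)
  then obtain r :: "nat \<Rightarrow> nat" where r: "strict_mono r" "\<And>n. \<theta> (r n) \<notin> S \<and> \<theta> (r n) \<in> K"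
    by (rule frequently_subseq) blast
  then obtain l q where q: "l \<in> K" "strict_mono q" "(\<lambda>n. \<theta> (r (q n))) \<longlonglongrightarrow> l"
    using seq_compactE[OF compact_imp_seq_compact[OF assms(1)], of "\<lambda>n. \<theta> (r n)"]
    unfolding o_def by metis
  then have "l = x" using assms(3)[of "r \<circ> q" l] r by (simp add: strict_mono_o)
  then have "\<forall>\<^sub>F n in sequentially. \<theta> (r (q n)) \<in> S" using q(3) S topological_tendstoD by blast
  then show False using r(2) by simp
qed

lemma tendsto_dist_transform:
  assumes "((\<lambda>n. dist (a n) (b n)) \<longlongrightarrow> 0) F" and "(b \<longlongrightarrow> l) F"
  shows "(a \<longlongrightarrow> l) F"
proof -
  have "((\<lambda>n. dist (a n) (b n) + dist (b n) l) \<longlongrightarrow> 0) F"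
    using tendsto_add[OF assms(1) assms(2)[unfolded tendsto_dist_iff[of b]]] by simp
  then have "((\<lambda>n. dist (a n) l) \<longlongrightarrow> 0) F"
    by (rule tendsto_sandwich[OF _ _ tendsto_const, rotated 2]) (auto intro: always_eventually dist_triangle)
  then show ?thesis using tendsto_dist_iff[of a] by blast
qed

lemma (in semidynamical_system) flow_tendsto:
  assumes "(z \<longlongrightarrow> w) F" and "(s \<longlongrightarrow> t) F" and "\<forall>\<^sub>F n in F. s n \<ge> 0" and "t \<ge> 0"
  shows "((\<lambda>n. \<rho> (z n) (s n)) \<longlongrightarrow> \<rho> w t) F"
proof -
  have "((\<lambda>n. case (z n, s n) of (z, t) \<Rightarrow> \<rho> z t) \<longlongrightarrow> (case (w, t) of (z, t) \<Rightarrow> \<rho> z t)) F"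
    by (rule continuous_on_tendsto_compose[OF flow_continuous])
      (use assms in \<open>auto intro: tendsto_Pair elim: eventually_mono\<close>)
  then show ?thesis by simp
qed

section \<open>First hitting times and impulse stages\<close>

context impulsive_system
begin

abbreviation "\<phi> \<equiv> hit_time \<rho> M"
abbreviation "\<tau> \<equiv> imp_traj \<rho> M I"
abbreviation "jump z \<equiv> I (\<rho> z (real_of_ereal (\<phi> z)))"

text \<open>This gives meaning to the \<open>LEAST\<close> in \<open>hit_time\<close>, since a set
  of positive reals need not have a least element.\<close>

lemma flow_hits_least:
  assumes "s > 0" "\<rho> z s \<in> M"
  shows "\<exists>u>0. \<rho> z u \<in> M \<and> (\<forall>r>0. \<rho> z r \<in> M \<longrightarrow> u \<le> r)"
proof -
  \<comment> \<open>Hits cannot accumulate at time 0: on \<open>M\<close> this is the isolation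
    axiom, off \<open>M\<close> it follows from continuity and closedness of
    \<open>M\<close>.\<close>
  have "\<exists>\<epsilon>>0. \<forall>r. 0 < r \<and> r < \<epsilon> \<longrightarrow> \<rho> z r \<notin> M"
  proof (cases "z \<in> M")
    case True
    then show ?thesis using impulsive_set_isolated[of z] by fastforce
  next
    case False
    have "((\<lambda>r. \<rho> z r) \<longlongrightarrow> \<rho> z 0) (at_right 0)"
      by (rule flow_tendsto) (auto simp: eventually_at_filter)
    then have "\<forall>\<^sub>F r in at_right 0. \<rho> z r \<in> - M"
      by (rule topological_tendstoD) (use False impulsive_set_closed in \<open>auto simp: flow_zero\<close>)
    then show ?thesis by (auto simp: eventually_at_right_field)
  qed
  then obtain \<epsilon> where e: "\<epsilon> > 0" "\<And>r. 0 < r \<Longrightarrow> r < \<epsilon> \<Longrightarrow> \<rho> z r \<notin> M" by blast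
  \<comment> \<open>Cutting off below at \<open>\<epsilon>\<close> and above at the known hit
    \<open>s\<close> makes the set of hits compact and keeps the earliest one.\<close>
  define A where "A = {\<epsilon>..s} \<inter> (\<lambda>r. \<rho> z r) -` M"
  have "continuous_on {\<epsilon>..s} (\<rho> z)"
    unfolding continuous_on_def using e(1)
    by (auto intro!: flow_tendsto simp: eventually_at_filter)
  then have "closed A" unfolding A_def
    by (rule continuous_closed_preimage) (auto simp: impulsive_set_closed)
  then have "compact A" by (metis A_def bounded_Int bounded_closed_interval compact_eq_bounded_closed)
  moreover have "s \<in> A" using assms e(2)[of s] unfolding A_def by force
  ultimately obtain u where u: "u \<in> A" "\<And>r. r \<in> A \<Longrightarrow> u \<le> r"
    by (metis compact_attains_inf empty_iff)
  have "u \<le> r" if "r > 0" "\<rho> z r \<in> M" for r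
    using u(1) u(2)[of r] e(2)[of r] that unfolding A_def by force
  then show ?thesis using u(1) e(1) unfolding A_def by (intro exI[of _ u]) auto
qed

lemma hit_time_cases:
  obtains (never) "\<phi> z = \<infinity>" "\<And>s. s > 0 \<Longrightarrow> \<rho> z s \<notin> M"
  | (hit) s where "\<phi> z = ereal s" "s > 0" "\<rho> z s \<in> M" "\<And>r. r > 0 \<Longrightarrow> \<rho> z r \<in> M \<Longrightarrow> s \<le> r"
proof (cases "\<exists>s>0. \<rho> z s \<in> M")
  case True
  then obtain u where u: "u > 0" "\<rho> z u \<in> M" "\<And>r. r > 0 \<Longrightarrow> \<rho> z r \<in> M \<Longrightarrow> u \<le> r"
    using flow_hits_least by blast
  then have "(LEAST s. s > 0 \<and> \<rho> z s \<in> M) = u" by (intro Least_equality) auto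
  then show ?thesis using True u that(2)[of u] by (auto simp: hit_time_def)
qed (auto simp: hit_time_def intro: that)

lemma hit_time_pos: "\<phi> z > 0"
  by (cases z rule: hit_time_cases) auto

lemma hit_time_le: "s > 0 \<Longrightarrow> \<rho> z s \<in> M \<Longrightarrow> \<phi> z \<le> ereal s"
  by (cases z rule: hit_time_cases) auto

lemma hit_time_real:
  assumes "\<phi> z = ereal s"
  shows "s > 0" "\<rho> z s \<in> M"
  using assms by (cases z rule: hit_time_cases; simp)+

text \<open>Positive hits of \<open>\<rho> z t\<close> are the hits of \<open>z\<close> after time
  \<open>t\<close>, shifted by \<open>t\<close>, and \<open>z\<close> has no positive hit up to
  \<open>t\<close>. The arithmetic in \<open>ereal\<close> covers the orbits that never hit.\<close>

lemma hit_time_flow: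
  assumes "t \<ge> 0" "ereal t < \<phi> z"
  shows "\<phi> z = ereal t + \<phi> (\<rho> z t)"
proof (cases z rule: hit_time_cases)
  case never
  show ?thesis
  proof (cases "\<rho> z t" rule: hit_time_cases)
    case (hit s)
    then show ?thesis using never(2)[of "t + s"] assms(1) by (simp add: flow_add)
  qed (use never in auto)
next
  case (hit s)
  have st: "t < s" using hit assms by simp
  show ?thesis
  proof (cases "\<rho> z t" rule: hit_time_cases)
    case never
    then show ?thesis using st hit assms(1) never(2)[of "s - t"] by (simp add: flow_add)
  next
    case h: (hit r)
    have "r \<le> s - t" by (rule h(4)) (use st hit assms(1) in \<open>auto simp: flow_add\<close>)
    moreover have "s \<le> t + r" by (rule hit(4)) (use h assms(1) in \<open>auto simp: flow_add\<close>)
    ultimately show ?thesis using hit h by simp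
  qed
qed

text \<open>The definition adds impulses at the end; this and the next lemma split off the first
  impulse instead, so that later inductions can restart the trajectory at
  \<open>jump z\<close>.\<close>

lemma imp_point_Suc: "imp_point \<rho> M I z (Suc n) = imp_point \<rho> M I (jump z) n"
  by (induction n) (simp_all add: Let_def)

lemma imp_time_Suc: "imp_time \<rho> M I z (Suc n) = \<phi> z + imp_time \<rho> M I (jump z) n"
  by (induction n) (simp_all add: imp_point_Suc add.assoc del: imp_point.simps(2))

lemma imp_time_mono: "m \<le> n \<Longrightarrow> imp_time \<rho> M I z m \<le> imp_time \<rho> M I z n"
  by (rule lift_Suc_mono_le) (auto intro!: ereal_le_add_self less_imp_le[OF hit_time_pos])

lemma imp_time_nonneg: "imp_time \<rho> M I z n \<ge> 0"
  using imp_time_mono[of 0 n z] by simp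

text \<open>Impulse times do not decrease, so a later stage starts no earlier than a previous one
  ends. This justifies the definite description in \<open>imp_traj\<close>.\<close>

lemma imp_stage_unique:
  assumes "imp_stage \<rho> M I z t m" "imp_stage \<rho> M I z t n"
  shows "m = n"
proof -
  have "\<not> m < n" if "imp_stage \<rho> M I z t m" "imp_stage \<rho> M I z t n" for m n
    using that imp_time_mono[of "Suc m" n z] unfolding imp_stage_def
    by (meson Suc_leI leD le_less_trans less_le_trans)
  then show ?thesis using assms by (meson linorder_neqE_nat)
qed

lemma imp_traj_stage:
  assumes "imp_stage \<rho> M I z t n"
  shows "\<tau> z t = \<rho> (imp_point \<rho> M I z n) (t - real_of_ereal (imp_time \<rho> M I z n))"
proof -
  have "(THE n. imp_stage \<rho> M I z t n) = n"
    using assms imp_stage_unique by blast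
  then show ?thesis by (simp add: imp_traj_def)
qed

lemma imp_stage_0: "imp_stage \<rho> M I z t 0 \<longleftrightarrow> 0 \<le> t \<and> ereal t < \<phi> z"
  by (simp add: imp_stage_def)

text \<open>For \<open>t < s\<close> both sides are false, because impulse times are nonnegative;
  hence no comparison of \<open>t\<close> with \<open>s\<close> is assumed.\<close>

lemma imp_stage_Suc:
  assumes "\<phi> z = ereal s"
  shows "imp_stage \<rho> M I z t (Suc n) \<longleftrightarrow> imp_stage \<rho> M I (jump z) (t - s) n"
  unfolding imp_stage_def imp_time_Suc[of z] assms
  using imp_time_nonneg[of "jump z" n] imp_time_nonneg[of "jump z" "Suc n"]
  by (cases "imp_time \<rho> M I (jump z) n"; cases "imp_time \<rho> M I (jump z) (Suc n)")
    (auto simp: assms simp del: imp_time.simps)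

lemma imp_stage_SucD:
  assumes "imp_stage \<rho> M I z t (Suc n)"
  obtains s where "\<phi> z = ereal s" "s \<le> t"
proof (cases z rule: hit_time_cases)
  case never
  then show ?thesis using assms imp_time_nonneg[of "jump z" n]
    by (auto simp: imp_stage_def imp_time_Suc[of z] simp del: imp_time.simps)
next
  case (hit s)
  have "ereal s \<le> imp_time \<rho> M I z (Suc n)"
    using imp_time_mono[of 1 "Suc n" z] hit by simp
  also have "\<dots> \<le> ereal t" using assms by (simp add: imp_stage_def del: imp_time.simps)
  finally show ?thesis using hit that by simp
qed

lemma imp_traj_before_hit: "t \<ge> 0 \<Longrightarrow> ereal t < \<phi> z \<Longrightarrow> \<tau> z t = \<rho> z t"
  using imp_traj_stage[of z t 0] by (simp add: imp_stage_0)

end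

section \<open>Semigroup law of the impulsive trajectories\<close>

context standing_impulsive_system
begin

text \<open>A stage of \<open>jump z\<close> containing \<open>t - s\<close> exists because
  trajectories are global; raising its index by one gives the stage of \<open>z\<close> containing
  \<open>t\<close>.\<close>

lemma imp_traj_after_hit:
  assumes "\<phi> z = ereal s" "s \<le> t"
  shows "\<tau> z t = \<tau> (jump z) (t - s)"
proof -
  obtain n where n: "imp_stage \<rho> M I (jump z) (t - s) n"
    using traj_defined[of "t - s" "jump z"] assms(2) by (auto simp: imp_traj_defined_def)
  then have "imp_time \<rho> M I (jump z) n \<le> ereal (t - s)" by (simp add: imp_stage_def)
  then obtain r where r: "imp_time \<rho> M I (jump z) n = ereal r"
    using imp_time_nonneg[of "jump z" n] by (cases "imp_time \<rho> M I (jump z) n") auto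
  have "imp_time \<rho> M I z (Suc n) = ereal (s + r)"
    unfolding imp_time_Suc[of z] r by (simp add: assms(1))
  moreover have "imp_stage \<rho> M I z t (Suc n)" using n imp_stage_Suc[OF assms(1)] by blast
  ultimately show ?thesis
    using imp_traj_stage[of z t "Suc n"] imp_traj_stage[OF n] r imp_point_Suc[of z n]
    by (simp add: algebra_simps del: imp_point.simps imp_time.simps)
qed

lemma imp_traj_0: "\<tau> z 0 = z"
  using imp_traj_before_hit[of 0 z] hit_time_pos[of z] by (simp add: flow_zero zero_ereal_def)

text \<open>Induction on the stage containing \<open>t\<close>. If an impulse precedes
  \<open>t\<close>, both sides restart at \<open>jump z\<close>, with one stage fewer. Otherwise
  only the flow acts up to \<open>t\<close>, and the next impulse is the same seen from
  \<open>z\<close> and from \<open>\<rho> z t\<close>.\<close>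

lemma imp_traj_add:
  assumes "t \<ge> 0" "s \<ge> 0"
  shows "\<tau> (\<tau> z t) s = \<tau> z (t + s)"
proof -
  obtain n where "imp_stage \<rho> M I z t n"
    using traj_defined[OF assms(1)] by (auto simp: imp_traj_defined_def)
  then show ?thesis using assms(1)
  proof (induction n arbitrary: z t)
    case 0
    then have t: "ereal t < \<phi> z" by (simp add: imp_stage_0)
    note f = hit_time_flow[OF 0(2) t]
    have w: "\<tau> z t = \<rho> z t" using imp_traj_before_hit 0 t by blast
    show ?case
    proof (cases "ereal s < \<phi> (\<rho> z t)")
      case True
      then have "ereal (t + s) < \<phi> z" unfolding f by (cases "\<phi> (\<rho> z t)") auto
      then show ?thesis using True w 0 assms(2) by (simp add: imp_traj_before_hit flow_add)
    next
      case False
      then obtain r where r: "\<phi> (\<rho> z t) = ereal r" "r \<le> s" "r > 0"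
        using hit_time_pos[of "\<rho> z t"] by (cases "\<phi> (\<rho> z t)") auto
      then have z: "\<phi> z = ereal (t + r)" using f by simp
      have "\<tau> (\<tau> z t) s = \<tau> (jump (\<rho> z t)) (s - r)"
        using w r imp_traj_after_hit by simp
      also have "jump (\<rho> z t) = jump z" using r z 0 by (simp add: flow_add)
      also have "\<tau> (jump z) (s - r) = \<tau> z (t + s)"
        using imp_traj_after_hit[OF z, of "t + s"] r by simp
      finally show ?thesis .
    qed
  next
    case (Suc n)
    then obtain r where r: "\<phi> z = ereal r" "r \<le> t" using imp_stage_SucD by blast
    then have "imp_stage \<rho> M I (jump z) (t - r) n" using Suc.prems imp_stage_Suc by blast
    then have "\<tau> (\<tau> (jump z) (t - r)) s = \<tau> (jump z) (t - r + s)" using Suc.IH r by simp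
    then show ?case using imp_traj_after_hit[OF r(1)] r assms(2) by (simp add: algebra_simps)
  qed
qed

section \<open>Continuity of hitting times from the tube condition\<close>

text \<open>Every cluster point of the bounded times \<open>u n\<close> is a time at which
  \<open>v\<close> reaches the closed set \<open>L\<close>, and the disjointness in the tube
  condition leaves only \<open>\<theta>\<close>.\<close>

lemma tube_time_tendsto:
  fixes w :: "nat \<Rightarrow> 'a"
  assumes "closed L" and "w \<longlonglongrightarrow> v" and "\<rho> v \<theta> \<in> L" and "0 \<le> \<theta>" "\<theta> \<le> b"
    and disj: "\<And>\<mu> \<nu>. 0 \<le> \<mu> \<Longrightarrow> \<mu> < \<nu> \<Longrightarrow> \<nu> \<le> b \<Longrightarrow> pre_flow \<rho> L {\<mu>} \<inter> pre_flow \<rho> L {\<nu>} = {}"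
    and ev: "\<forall>\<^sub>F n in sequentially. u n \<in> {0..b} \<and> \<rho> (w n) (u n) \<in> L"
  shows "u \<longlonglongrightarrow> \<theta>"
proof -
  obtain N where N: "\<And>n. n \<ge> N \<Longrightarrow> u n \<in> {0..b} \<and> \<rho> (w n) (u n) \<in> L"
    using ev by (auto simp: eventually_sequentially)
  have "(\<lambda>n. u (n + N)) \<longlonglongrightarrow> \<theta>"
  proof (rule tendsto_compact_unique_limit[of "{0..b}"])
    fix r l assume r: "strict_mono r" "(\<lambda>n. u (r n + N)) \<longlonglongrightarrow> l" "l \<in> {0..b}"
    have "(\<lambda>n. w (r n + N)) \<longlonglongrightarrow> v"
      using LIMSEQ_subseq_LIMSEQ[OF LIMSEQ_ignore_initial_segment[OF assms(2)] r(1)]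
      by (simp add: o_def)
    then have "(\<lambda>n. \<rho> (w (r n + N)) (u (r n + N))) \<longlonglongrightarrow> \<rho> v l"
      by (rule flow_tendsto) (use r N in auto)
    then have "\<rho> v l \<in> L"
      by (rule Lim_in_closed_set[OF assms(1), rotated 2]) (use N in auto)
    then have "v \<in> pre_flow \<rho> L {l}" "v \<in> pre_flow \<rho> L {\<theta>}"
      using assms(3) by (auto simp: pre_flow_def)
    then show "l = \<theta>"
      using disj[of l \<theta>] disj[of \<theta> l] r(3) assms(4,5) by (cases l \<theta> rule: linorder_cases) auto
  qed (use N in auto)
  then show ?thesis by (simp add: LIMSEQ_ignore_initial_segment LIMSEQ_offset)
qed

text \<open>The bound \<open>c\<close> keeps hits from collapsing to time 0, which allows
  \<open>z\<close> to lie in \<open>M\<close>. The lower estimate holds because a limit of hits is a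
  hit; the upper one holds because the tube forces nearby orbits through the section.\<close>

lemma hit_time_tendsto:
  fixes w :: "nat \<Rightarrow> 'a"
  assumes w: "w \<longlonglongrightarrow> z" and c: "c > 0" and ev: "\<forall>\<^sub>F n in sequentially. ereal c \<le> \<phi> (w n)"
  shows "(\<lambda>n. \<phi> (w n)) \<longlonglongrightarrow> \<phi> z"
proof (rule order_tendstoI)
  fix a assume a: "a < \<phi> z"
  show "\<forall>\<^sub>F n in sequentially. a < \<phi> (w n)"
  proof (rule ccontr)
    assume "\<not> ?thesis"
    then have "\<exists>\<^sub>F n in sequentially. \<phi> (w n) \<le> a \<and> ereal c \<le> \<phi> (w n)"
      using ev by (auto intro: frequently_eventually_frequently simp: not_eventually not_less)
    then obtain r :: "nat \<Rightarrow> nat" where r: "strict_mono r" "\<And>n. \<phi> (w (r n)) \<le> a \<and> ereal c \<le> \<phi> (w (r n))"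
      by (rule frequently_subseq) blast
    \<comment> \<open>Together with \<open>a < \<phi> z\<close> this makes \<open>a\<close> finite,
      so the hitting times of the subsequence lie in a compact interval. Its left end
      \<open>c\<close> keeps their limit positive.\<close>
    then have "ereal c \<le> a" by (meson order_trans)
    then obtain b where b: "a = ereal b" using a by (cases a) auto
    define s where "s n = real_of_ereal (\<phi> (w (r n)))" for n
    have s: "\<phi> (w (r n)) = ereal (s n)" for n
      using r(2)[of n] b by (cases "\<phi> (w (r n))") (auto simp: s_def)
    have sb: "s n \<in> {c..b}" for n using r(2)[of n] s[of n] b by simp
    obtain l q where q: "l \<in> {c..b}" "strict_mono q" "(\<lambda>n. s (q n)) \<longlonglongrightarrow> l"
      using seq_compactE[OF compact_imp_seq_compact[OF compact_Icc[of c b]], of s] sb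
      unfolding o_def by metis
    have "(\<lambda>n. w (r (q n))) \<longlonglongrightarrow> z"
      using LIMSEQ_subseq_LIMSEQ[OF w strict_mono_o[OF r(1) q(2)]] by (simp add: o_def)
    then have "(\<lambda>n. \<rho> (w (r (q n))) (s (q n))) \<longlonglongrightarrow> \<rho> z l"
      using hit_time_real(1)[OF s] q(1,3) c by (auto intro!: flow_tendsto simp: less_imp_le)
    then have "\<rho> z l \<in> M"
      by (rule closed_sequentially[OF impulsive_set_closed hit_time_real(2)[OF s]])
    then have "\<phi> z \<le> ereal l" using q(1) c by (intro hit_time_le) auto
    also have "\<dots> \<le> a" using q(1) b by simp
    finally show False using a by simp
  qed
next
  fix a assume a: "\<phi> z < a"
  then obtain s where s: "\<phi> z = ereal s" using hit_time_pos[of z] by (cases "\<phi> z") auto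
  then have s0: "s > 0" and "\<rho> z s \<in> M" using hit_time_real by blast+
  then obtain l S L where l: "l > 0" and L: "closed L" "pre_flow \<rho> L {l} = S" "\<rho> z s \<in> S" "S \<subseteq> M"
    and nb: "\<rho> z s \<in> interior (pre_flow \<rho> L {0..2 * l})"
    and disj: "\<And>\<mu> \<nu>. 0 \<le> \<mu> \<Longrightarrow> \<mu> < \<nu> \<Longrightarrow> \<nu> \<le> 2 * l \<Longrightarrow> pre_flow \<rho> L {\<mu>} \<inter> pre_flow \<rho> L {\<nu>} = {}"
    using stc[of "\<rho> z s"] unfolding strong_tube_condition_def by (metis Int_lower1)
  \<comment> \<open>Step back by a small \<open>d\<close> before the hit. The point
    \<open>\<rho> z (s - d)\<close> is still interior to the tube, so nearby orbits are in the tube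
    too. It reaches \<open>L\<close> after time \<open>d + l\<close>, which is at most
    \<open>2 * l\<close> and greater than \<open>l\<close>, so that nearby orbits still have the
    section ahead of them.\<close>
  have "((\<lambda>d. \<rho> z (s - d)) \<longlongrightarrow> \<rho> z (s - 0)) (at_right 0)"
    using s0 by (intro flow_tendsto tendsto_intros) (auto simp: eventually_at_right_field intro!: exI[of _ s])
  then have "\<forall>\<^sub>F d in at_right 0. \<rho> z (s - d) \<in> interior (pre_flow \<rho> L {0..2 * l})"
    by (rule topological_tendstoD) (use nb in auto)
  moreover have "\<forall>\<^sub>F d in at_right 0. d < l \<and> d < s"
    using s0 l by (auto simp: eventually_at_right_field intro!: exI[of _ "min s l"])
  moreover have "\<forall>\<^sub>F d in at_right 0. d > (0::real)" by (simp add: eventually_at_filter)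
  ultimately have "\<forall>\<^sub>F d in at_right 0. \<rho> z (s - d) \<in> interior (pre_flow \<rho> L {0..2 * l}) \<and> d < l \<and> d < s \<and> d > 0"
    by eventually_elim blast
  then obtain d where d: "\<rho> z (s - d) \<in> interior (pre_flow \<rho> L {0..2 * l})" "d < l" "d < s" "d > 0"
    using eventually_happens[of _ "at_right (0::real)"] by force
  have lim: "(\<lambda>n. \<rho> (w n) (s - d)) \<longlonglongrightarrow> \<rho> z (s - d)"
    by (rule flow_tendsto[OF w]) (use d in auto)
  then have "\<forall>\<^sub>F n in sequentially. \<rho> (w n) (s - d) \<in> interior (pre_flow \<rho> L {0..2 * l})"
    by (rule topological_tendstoD) (use d in auto)
  then have "\<forall>\<^sub>F n in sequentially. \<exists>u. u \<in> {0..2 * l} \<and> \<rho> (\<rho> (w n) (s - d)) u \<in> L"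
    by (rule eventually_mono) (use interior_subset in \<open>fastforce simp: pre_flow_def\<close>)
  then obtain u where u: "\<forall>\<^sub>F n in sequentially. u n \<in> {0..2 * l} \<and> \<rho> (\<rho> (w n) (s - d)) (u n) \<in> L"
    unfolding eventually_ex by blast
  have "\<rho> (\<rho> z s) l \<in> L" using L(2,3) by (auto simp: pre_flow_def)
  then have "\<rho> (\<rho> z (s - d)) (d + l) \<in> L"
    using d l s0 by (simp add: flow_add)
  then have ul: "u \<longlonglongrightarrow> d + l"
    using tube_time_tendsto[OF L(1) lim _ _ _ disj u] d l by simp
  then have "\<forall>\<^sub>F n in sequentially. u n > l" using d by (intro order_tendstoD(1)) auto
  moreover have "(\<lambda>n. ereal (s - d + (u n - l))) \<longlonglongrightarrow> ereal (s - d + (d + l - l))"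
    by (intro tendsto_intros ul)
  then have "\<forall>\<^sub>F n in sequentially. ereal (s - d + (u n - l)) < a"
    using a s by (intro order_tendstoD(2)) auto
  ultimately show "\<forall>\<^sub>F n in sequentially. \<phi> (w n) < a" using u
  proof eventually_elim
    case (elim n)
    \<comment> \<open>The section \<open>S\<close> is exactly the set of points reaching
      \<open>L\<close> after time \<open>l\<close>, so the orbit crosses it \<open>l\<close> before
      its arrival in \<open>L\<close>.\<close>
    have "\<rho> (\<rho> (w n) (s - d + (u n - l))) l = \<rho> (\<rho> (w n) (s - d)) (u n)"
      using elim d l by (simp add: flow_add algebra_simps)
    then have "\<rho> (w n) (s - d + (u n - l)) \<in> S"
      using elim(3) L(2) by (auto simp: pre_flow_def)
    then have "\<phi> (w n) \<le> ereal (s - d + (u n - l))"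
      using elim d L(4) by (intro hit_time_le) auto
    then show ?case using elim(2) by order
  qed
qed

text \<open>Failure of a uniform lower bound gives indices \<open>r k \<ge> k\<close> with hitting
  times below \<open>1 / (k + 1)\<close>. The flow moves hardly at all in such times, so the hit
  points have the limit \<open>z\<close> as well, and \<open>M\<close> is closed. The indices need
  not increase strictly.\<close>

lemma vanishing_hit_times:
  fixes w :: "nat \<Rightarrow> 'a"
  assumes w: "w \<longlonglongrightarrow> z" and "\<not> (\<exists>c>0. \<forall>\<^sub>F n in sequentially. ereal c \<le> \<phi> (w n))"
  obtains r s where "filterlim r at_top sequentially" "\<And>n. \<phi> (w (r n)) = ereal (s n)" "s \<longlonglongrightarrow> 0"
    "(\<lambda>n. \<rho> (w (r n)) (s n)) \<longlonglongrightarrow> z" "z \<in> M"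
proof -
  have "\<exists>n\<ge>k. \<phi> (w n) < ereal (1 / real (Suc k))" for k
    using assms(2) unfolding eventually_sequentially by (metis not_le of_nat_0_less_iff zero_less_Suc zero_less_divide_1_iff)
  then obtain r where r: "\<And>k. r k \<ge> k" "\<And>k. \<phi> (w (r k)) < ereal (1 / real (Suc k))" by metis
  define s where "s k = real_of_ereal (\<phi> (w (r k)))" for k
  have s: "\<phi> (w (r k)) = ereal (s k)" for k
    using r(2)[of k] hit_time_pos[of "w (r k)"] by (cases "\<phi> (w (r k))") (auto simp: s_def)
  have rl: "filterlim r at_top sequentially"
    using r(1) by (intro filterlim_at_top_mono[OF filterlim_ident]) auto
  have s0: "s \<longlonglongrightarrow> 0"
  proof (rule tendsto_sandwich[OF _ _ tendsto_const])
    show "(\<lambda>k. 1 / real (Suc k)) \<longlonglongrightarrow> 0" by (rule LIMSEQ_Suc[OF lim_1_over_n])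
    show "\<forall>\<^sub>F n in sequentially. 0 \<le> s n" using less_imp_le[OF hit_time_real(1)[OF s]] by simp
    show "\<forall>\<^sub>F n in sequentially. s n \<le> 1 / real (Suc n)"
      using less_imp_le[OF r(2)] unfolding s by (simp del: of_nat_Suc)
  qed
  have "(\<lambda>n. \<rho> (w (r n)) (s n)) \<longlonglongrightarrow> \<rho> z 0"
    by (intro flow_tendsto s0 filterlim_compose[OF w rl])
      (use hit_time_real(1)[OF s] in \<open>auto simp: less_imp_le\<close>)
  then have l: "(\<lambda>n. \<rho> (w (r n)) (s n)) \<longlonglongrightarrow> z" by (simp add: flow_zero)
  then have "z \<in> M"
    by (rule closed_sequentially[OF impulsive_set_closed hit_time_real(2)[OF s]])
  then show thesis using that rl s s0 l by blast
qed

lemma hit_time_bounded_below: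
  fixes w :: "nat \<Rightarrow> 'a"
  assumes "w \<longlonglongrightarrow> z" "z \<notin> M"
  shows "\<exists>c>0. \<forall>\<^sub>F n in sequentially. ereal c \<le> \<phi> (w n)"
  using vanishing_hit_times assms by metis

section \<open>Convergence of impulsive trajectories up to vanishing delays\<close>

text \<open>Induction on the number of impulses of \<open>z\<close> up to time \<open>t\<close>. The
  delays \<open>e\<close> are chosen before \<open>s\<close>, so any larger vanishing delay works as
  well; this allows the delays of two systems to be added.\<close>

lemma imp_traj_tendsto:
  fixes w :: "nat \<Rightarrow> 'a"
  assumes "w \<longlonglongrightarrow> z" and "\<exists>c>0. \<forall>\<^sub>F n in sequentially. ereal c \<le> \<phi> (w n)" and "t \<ge> 0"
  shows "\<exists>e. (\<forall>n. e n \<ge> 0) \<and> e \<longlonglongrightarrow> 0 \<and>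
    (\<forall>s. s \<longlonglongrightarrow> t \<longrightarrow> (\<forall>\<^sub>F n in sequentially. t + e n \<le> s n) \<longrightarrow> (\<lambda>n. \<tau> (w n) (s n)) \<longlonglongrightarrow> \<tau> z t)"
proof -
  obtain k where "imp_stage \<rho> M I z t k"
    using traj_defined[OF assms(3)] by (auto simp: imp_traj_defined_def)
  then show ?thesis using assms
  proof (induction k arbitrary: w z t)
    \<comment> \<open>Before the first impulse of \<open>z\<close>, continuity of the flow and of
      the hitting time suffices, with zero delay.\<close>
    case 0
    then have t: "ereal t < \<phi> z" by (simp add: imp_stage_0)
    have \<phi>: "(\<lambda>n. \<phi> (w n)) \<longlonglongrightarrow> \<phi> z" using 0 hit_time_tendsto by blast
    have "(\<lambda>n. \<tau> (w n) (s n)) \<longlonglongrightarrow> \<tau> z t"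
      if s: "s \<longlonglongrightarrow> t" "\<forall>\<^sub>F n in sequentially. t + 0 \<le> s n" for s
    proof -
      obtain b where b: "ereal t < b" "b < \<phi> z" using dense t by blast
      have "\<forall>\<^sub>F n in sequentially. ereal (s n) < b"
        by (rule order_tendstoD(2)[OF _ b(1)]) (use s in auto)
      moreover have "\<forall>\<^sub>F n in sequentially. b < \<phi> (w n)" by (rule order_tendstoD(1)[OF \<phi> b(2)])
      ultimately have "\<forall>\<^sub>F n in sequentially. \<rho> (w n) (s n) = \<tau> (w n) (s n)" using s(2)
        by eventually_elim (use 0(4) in \<open>simp add: imp_traj_before_hit\<close>)
      moreover have "(\<lambda>n. \<rho> (w n) (s n)) \<longlonglongrightarrow> \<rho> z t"
        by (rule flow_tendsto) (use 0 s in \<open>auto elim: eventually_mono\<close>)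
      ultimately have "(\<lambda>n. \<tau> (w n) (s n)) \<longlonglongrightarrow> \<rho> z t"
        by (rule Lim_transform_eventually[rotated])
      then show ?thesis using t 0(4) by (simp add: imp_traj_before_hit)
    qed
    then show ?case by (intro exI[of _ "\<lambda>_. 0"]) simp
  next
    case (Suc k)
    then obtain f where f: "\<phi> z = ereal f" "f \<le> t" using imp_stage_SucD by blast
    have f0: "f > 0" and fM: "\<rho> z f \<in> M" using hit_time_real[OF f(1)] by blast+
    define a where "a n = real_of_ereal (\<phi> (w n))" for n
    have \<phi>: "(\<lambda>n. \<phi> (w n)) \<longlonglongrightarrow> ereal f" using Suc hit_time_tendsto f by metis
    \<comment> \<open>Eventually the hitting times are finite, so \<open>a n\<close> is a true
      hitting time and not a default value of \<open>real_of_ereal\<close>.\<close>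
    have "\<forall>\<^sub>F n in sequentially. \<phi> (w n) < \<infinity>" by (rule order_tendstoD(2)[OF \<phi>]) simp
    then have ev: "\<forall>\<^sub>F n in sequentially. \<phi> (w n) = ereal (a n)"
      by (rule eventually_mono)
        (use hit_time_pos in \<open>metis a_def ereal_infty_less(1) ereal_real' abs_ereal_ge0 less_imp_le\<close>)
    have a: "a \<longlonglongrightarrow> f" unfolding a_def using \<phi> by (rule lim_real_of_ereal)
    have "(\<lambda>n. \<rho> (w n) (a n)) \<longlonglongrightarrow> \<rho> z f"
    proof (rule flow_tendsto[OF Suc.prems(2) a])
      show "\<forall>\<^sub>F n in sequentially. 0 \<le> a n"
        using ev by (rule eventually_mono) (use hit_time_real(1) less_imp_le in blast)
    qed (use f0 in simp)
    then have "(\<lambda>n. I (\<rho> (w n) (a n))) \<longlonglongrightarrow> I (\<rho> z f)"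
      by (rule continuous_on_tendsto_compose[OF impulse_continuous _ fM])
        (use ev hit_time_real(2) in \<open>auto elim: eventually_mono\<close>)
    then have w1: "(\<lambda>n. jump (w n)) \<longlonglongrightarrow> jump z" by (simp add: a_def f)
    \<comment> \<open>As impulses lead off the impulsive set, the restarted points satisfy the lower
      bound on hitting times automatically, and the induction hypothesis applies.\<close>
    have z1: "jump z \<notin> M" using fM impulse_leaves f by auto
    have "imp_stage \<rho> M I (jump z) (t - f) k" using Suc.prems(1) imp_stage_Suc f by blast
    from Suc.IH[OF this w1 hit_time_bounded_below[OF w1 z1]] f
    obtain e where e: "\<And>n. e n \<ge> 0" "e \<longlonglongrightarrow> 0"
      "\<And>s. s \<longlonglongrightarrow> t - f \<Longrightarrow> \<forall>\<^sub>F n in sequentially. t - f + e n \<le> s n \<Longrightarrow>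
        (\<lambda>n. \<tau> (jump (w n)) (s n)) \<longlonglongrightarrow> \<tau> (jump z) (t - f)" by auto
    \<comment> \<open>The extra delay \<open>\<bar>a n - f\<bar>\<close> ensures both that
      \<open>w n\<close> has jumped by time \<open>s n\<close> and that at least
      \<open>t - f + e n\<close> remains after its jump.\<close>
    have "(\<lambda>n. \<tau> (w n) (s n)) \<longlonglongrightarrow> \<tau> z t"
      if s: "s \<longlonglongrightarrow> t" "\<forall>\<^sub>F n in sequentially. t + (e n + \<bar>a n - f\<bar>) \<le> s n" for s
    proof -
      have "(\<lambda>n. \<tau> (jump (w n)) (s n - a n)) \<longlonglongrightarrow> \<tau> (jump z) (t - f)"
        by (intro e(3) tendsto_intros s a eventually_mono[OF s(2)]) auto
      moreover have "\<forall>\<^sub>F n in sequentially. \<tau> (jump (w n)) (s n - a n) = \<tau> (w n) (s n)"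
        using ev s(2)
      proof eventually_elim
        case (elim n)
        then show ?case using imp_traj_after_hit[OF elim(1), of "s n"] e(1)[of n] f(2) by simp
      qed
      ultimately have "(\<lambda>n. \<tau> (w n) (s n)) \<longlonglongrightarrow> \<tau> (jump z) (t - f)"
        by (rule Lim_transform_eventually)
      then show ?thesis using imp_traj_after_hit[OF f] by simp
    qed
    moreover have "(\<lambda>n. e n + \<bar>a n - f\<bar>) \<longlonglongrightarrow> 0 + \<bar>f - f\<bar>" by (intro tendsto_intros e a)
    ultimately show ?case using e(1) by (intro exI[of _ "\<lambda>n. e n + \<bar>a n - f\<bar>"]) auto
  qed
qed

section \<open>Limit sequences under delays and time shifts\<close>

text \<open>Near a point off \<open>M\<close> hitting times are bounded below, so a vanishing delay
  is eventually too short for an impulse, and the flow over it tends to the identity.\<close>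

lemma lim_seqs_at_shift:
  assumes "q \<notin> M" and t: "t \<in> lim_seqs_at \<tau> x q" and r: "filterlim r at_top sequentially"
    and e: "\<And>n. e n \<ge> 0" "e \<longlonglongrightarrow> 0"
  shows "(\<lambda>n. t (r n) + e n) \<in> lim_seqs_at \<tau> x q"
proof -
  have t0: "\<And>n. t n \<ge> 0" and tl: "filterlim t at_top sequentially"
    and q: "(\<lambda>n. \<tau> x (t n)) \<longlonglongrightarrow> q"
    using t by (auto simp: lim_seqs_at_def)
  have w: "(\<lambda>n. \<tau> x (t (r n))) \<longlonglongrightarrow> q" by (rule filterlim_compose[OF q r])
  obtain c where c: "c > 0" "\<forall>\<^sub>F n in sequentially. ereal c \<le> \<phi> (\<tau> x (t (r n)))"
    using hit_time_bounded_below[OF w assms(1)] by blast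
  have "\<forall>\<^sub>F n in sequentially. e n < c" by (rule order_tendstoD(2)[OF e(2) c(1)])
  with c(2) have "\<forall>\<^sub>F n in sequentially. \<rho> (\<tau> x (t (r n))) (e n) = \<tau> x (t (r n) + e n)"
  proof eventually_elim
    case (elim n)
    then have "ereal (e n) < \<phi> (\<tau> x (t (r n)))" using less_le_trans less_ereal.simps(1) by blast
    then show ?case using imp_traj_before_hit[of "e n"] e(1) imp_traj_add t0 by metis
  qed
  moreover have "(\<lambda>n. \<rho> (\<tau> x (t (r n))) (e n)) \<longlonglongrightarrow> \<rho> q 0"
    by (rule flow_tendsto[OF w e(2)]) (use e(1) in auto)
  ultimately have "(\<lambda>n. \<tau> x (t (r n) + e n)) \<longlonglongrightarrow> q"
    using Lim_transform_eventually flow_zero by metis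
  moreover have "filterlim (\<lambda>n. t (r n) + e n) at_top sequentially"
    by (rule filterlim_at_top_mono[OF filterlim_compose[OF tl r]]) (use e(1) in auto)
  ultimately show ?thesis using t0 e(1) by (auto simp: lim_seqs_at_def)
qed

lemma lim_seqs_at_add:
  assumes q: "(\<lambda>n. \<tau> (\<tau> x (t n)) (s n)) \<longlonglongrightarrow> q'" and t: "t \<in> lim_seqs_at \<tau> x q" and "\<And>n. s n \<ge> 0"
  shows "(\<lambda>n. t n + s n) \<in> lim_seqs_at \<tau> x q'"
proof -
  have t0: "\<And>n. t n \<ge> 0" and tl: "filterlim t at_top sequentially"
    using t by (auto simp: lim_seqs_at_def)
  moreover have "filterlim (\<lambda>n. t n + s n) at_top sequentially"
    by (rule filterlim_at_top_mono[OF tl]) (use assms(3) in auto)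
  ultimately show ?thesis using assms(3) q by (auto simp: lim_seqs_at_def imp_traj_add)
qed

text \<open>If \<open>x\<close> approaches \<open>q\<close> along \<open>u n\<close>, then it
  approaches \<open>\<tau> q t\<close> along \<open>u n + t + e n\<close>, where \<open>e\<close> is
  the delay after which trajectories converge.\<close>

lemma pos_limit_set_invariant:
  assumes "q \<in> pos_limit_set \<tau> x" "q \<notin> M" "t \<ge> 0"
  shows "\<tau> q t \<in> pos_limit_set \<tau> x"
proof -
  obtain u where u: "u \<in> lim_seqs_at \<tau> x q" using assms(1) by (auto simp: pos_limit_set_def)
  then have w: "(\<lambda>n. \<tau> x (u n)) \<longlonglongrightarrow> q" by (simp add: lim_seqs_at_def)
  obtain e where e: "\<And>n. e n \<ge> 0" "e \<longlonglongrightarrow> 0"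
    "\<And>s. s \<longlonglongrightarrow> t \<Longrightarrow> \<forall>\<^sub>F n in sequentially. t + e n \<le> s n \<Longrightarrow>
      (\<lambda>n. \<tau> (\<tau> x (u n)) (s n)) \<longlonglongrightarrow> \<tau> q t"
    using imp_traj_tendsto[OF w hit_time_bounded_below[OF w assms(2)] assms(3)] by auto
  have "(\<lambda>n. \<tau> (\<tau> x (u n)) (t + e n)) \<longlonglongrightarrow> \<tau> q t"
    using e(3)[of "\<lambda>n. t + e n"] tendsto_add[OF tendsto_const[of t] e(2)] by simp
  then have "(\<lambda>n. u n + (t + e n)) \<in> lim_seqs_at \<tau> x (\<tau> q t)"
    using lim_seqs_at_add u e(1) assms(3) by simp
  then show ?thesis by (auto simp: pos_limit_set_def)
qed

end

section \<open>Construction and continuity of the map between limit sets\<close>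

lemma lim_seqs_at_interleave:
  assumes "t \<in> lim_seqs_at \<tau> x q" "s \<in> lim_seqs_at \<tau> x q"
  shows "(\<lambda>n. if even n then t (n div 2) else s (n div 2)) \<in> lim_seqs_at \<tau> x q"
proof -
  have d: "filterlim (\<lambda>n::nat. n div 2) at_top sequentially"
    by (rule filterlim_at_top_div_const_nat) simp
  have "filterlim (\<lambda>n. if even n then a (n div 2) else b (n div 2)) F sequentially"
    if "filterlim a F sequentially" "filterlim b F sequentially" for a b :: "nat \<Rightarrow> 'c" and F
    by (intro filterlim_If) (auto intro!: filterlim_mono[OF filterlim_compose[OF _ d] order_refl] that simp: inf_le1)
  note this[of t at_top s] this[of "\<lambda>n. \<tau> x (t n)" "nhds q" "\<lambda>n. \<tau> x (s n)"]
  then show ?thesis using assms by (auto simp: lim_seqs_at_def if_distrib[of "\<tau> x"])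
qed

text \<open>Comparability makes \<open>y\<close> converge along the interleaved sequence; its even
  and odd terms then force the two limits to agree.\<close>

lemma comparable_in_limit_limit_unique:
  assumes "comparable_in_limit \<tau>' y \<tau> x"
    and t: "t \<in> lim_seqs_at \<tau> x q" "t \<in> lim_seqs_at \<tau>' y a"
    and s: "s \<in> lim_seqs_at \<tau> x q" "s \<in> lim_seqs_at \<tau>' y b"
  shows "a = b"
proof -
  define u where "u = (\<lambda>n. if even n then t (n div 2) else s (n div 2))"
  have "u \<in> lim_seqs \<tau> x" using lim_seqs_at_interleave[OF t(1) s(1)] by (auto simp: u_def lim_seqs_def)
  then obtain l where "(\<lambda>n. \<tau>' y (u n)) \<longlonglongrightarrow> l"
    using assms(1) unfolding comparable_in_limit_def lim_seqs_def lim_seqs_at_def by blast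
  note LIMSEQ_subseq_LIMSEQ[OF this, of "\<lambda>n. 2 * n"] LIMSEQ_subseq_LIMSEQ[OF this, of "\<lambda>n. Suc (2 * n)"]
  then have "(\<lambda>n. \<tau>' y (t n)) \<longlonglongrightarrow> l" "(\<lambda>n. \<tau>' y (s n)) \<longlonglongrightarrow> l"
    by (auto simp: u_def o_def strict_mono_def)
  moreover have "(\<lambda>n. \<tau>' y (t n)) \<longlonglongrightarrow> a" "(\<lambda>n. \<tau>' y (s n)) \<longlonglongrightarrow> b"
    using t(2) s(2) by (auto simp: lim_seqs_at_def)
  ultimately show ?thesis by (metis LIMSEQ_unique)
qed

lemma comparable_in_limit_map:
  assumes comp: "comparable_in_limit \<tau>' y \<tau> x"
  obtains h where "continuous_on (pos_limit_set \<tau> x) h"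
    "\<And>q. q \<in> pos_limit_set \<tau> x \<Longrightarrow> lim_seqs_at \<tau> x q \<subseteq> lim_seqs_at \<tau>' y (h q)"
proof -
  have "\<exists>a. lim_seqs_at \<tau> x q \<subseteq> lim_seqs_at \<tau>' y a" if q: "q \<in> pos_limit_set \<tau> x" for q
  proof -
    obtain t where t: "t \<in> lim_seqs_at \<tau> x q" using q by (auto simp: pos_limit_set_def)
    have ex: "\<exists>a. s \<in> lim_seqs_at \<tau>' y a" if "s \<in> lim_seqs_at \<tau> x q" for s
      using comp that by (force simp: comparable_in_limit_def lim_seqs_def)
    obtain a where a: "t \<in> lim_seqs_at \<tau>' y a" using ex t by blast
    have "s \<in> lim_seqs_at \<tau>' y a" if "s \<in> lim_seqs_at \<tau> x q" for s
      using ex[OF that] comparable_in_limit_limit_unique[OF comp t a that] by blast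
    then show ?thesis by blast
  qed
  then obtain h where h: "\<And>q. q \<in> pos_limit_set \<tau> x \<Longrightarrow> lim_seqs_at \<tau> x q \<subseteq> lim_seqs_at \<tau>' y (h q)"
    by metis
  have "(\<lambda>k. h (q k)) \<longlonglongrightarrow> h p"
    if p: "p \<in> pos_limit_set \<tau> x" and q: "\<And>k. q k \<in> pos_limit_set \<tau> x" "q \<longlonglongrightarrow> p" for p q
  proof -
    \<comment> \<open>Diagonal choice: one late time serves both systems, putting \<open>x\<close>
      near \<open>q k\<close> and \<open>y\<close> near \<open>h (q k)\<close>. Along these times
      \<open>x\<close> tends to \<open>p\<close>, hence \<open>y\<close> tends to
      \<open>h p\<close>, and \<open>h (q k)\<close> follows it.\<close>
    have "\<exists>t\<ge>real k. dist (\<tau> x t) (q k) < 1 / real (Suc k) \<and> dist (h (q k)) (\<tau>' y t) < 1 / real (Suc k)"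
      for k
    proof -
      obtain t where t: "t \<in> lim_seqs_at \<tau> x (q k)" using q(1)[of k] by (auto simp: pos_limit_set_def)
      then have "t \<in> lim_seqs_at \<tau>' y (h (q k))" using h q(1) by blast
      then have "(\<lambda>n. \<tau>' y (t n)) \<longlonglongrightarrow> h (q k)" by (simp add: lim_seqs_at_def)
      then have 1: "\<forall>\<^sub>F n in sequentially. dist (\<tau>' y (t n)) (h (q k)) < 1 / real (Suc k)"
        by (rule tendstoD) simp
      have 2: "\<forall>\<^sub>F n in sequentially. dist (\<tau> x (t n)) (q k) < 1 / real (Suc k)"
        by (rule tendstoD) (use t in \<open>auto simp: lim_seqs_at_def\<close>)
      have 3: "\<forall>\<^sub>F n in sequentially. real k \<le> t n"
        using t by (simp add: lim_seqs_at_def filterlim_at_top)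
      have "\<forall>\<^sub>F n in sequentially. real k \<le> t n \<and> dist (\<tau> x (t n)) (q k) < 1 / real (Suc k) \<and>
        dist (h (q k)) (\<tau>' y (t n)) < 1 / real (Suc k)"
        using 1 2 3 by eventually_elim (simp add: dist_commute)
      then show ?thesis using eventually_happens'[OF sequentially_bot] by blast
    qed
    then obtain t where t: "\<And>k. t k \<ge> real k" "\<And>k. dist (\<tau> x (t k)) (q k) < 1 / real (Suc k)"
      "\<And>k. dist (h (q k)) (\<tau>' y (t k)) < 1 / real (Suc k)" by metis
    have inv: "(\<lambda>k. 1 / real (Suc k)) \<longlonglongrightarrow> 0" by (rule LIMSEQ_Suc[OF lim_1_over_n])
    have "(\<lambda>k. \<tau> x (t k)) \<longlonglongrightarrow> p"
      by (rule tendsto_dist_transform[OF tendsto_sandwich[OF _ _ tendsto_const inv] q(2)])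
        (use t(2) in \<open>auto simp: less_imp_le simp del: of_nat_Suc\<close>)
    moreover have "filterlim t at_top sequentially"
      by (rule filterlim_at_top_mono[OF filterlim_real_sequentially]) (use t(1) in auto)
    moreover have "t k \<ge> 0" for k using t(1)[of k] of_nat_0_le_iff order_trans by blast
    ultimately have "t \<in> lim_seqs_at \<tau>' y (h p)" using h[OF p] by (auto simp: lim_seqs_at_def)
    then have y: "(\<lambda>k. \<tau>' y (t k)) \<longlonglongrightarrow> h p" by (simp add: lim_seqs_at_def)
    show ?thesis
      by (rule tendsto_dist_transform[OF tendsto_sandwich[OF _ _ tendsto_const inv] y])
        (use t(3) in \<open>auto simp: less_imp_le simp del: of_nat_Suc\<close>)
  qed
  then have "continuous_on (pos_limit_set \<tau> x) h"
    by (auto simp: continuous_on_sequentially o_def)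
  then show thesis using that h by blast
qed

section \<open>The map intertwines the impulsive trajectories\<close>

lemma comparable_map_semiconjugates:
  assumes "standing_impulsive_system \<pi> M J" and "standing_impulsive_system \<sigma> M' J'"
    and h: "\<And>q. q \<in> pos_limit_set (imp_traj \<pi> M J) x \<Longrightarrow>
      lim_seqs_at (imp_traj \<pi> M J) x q \<subseteq> lim_seqs_at (imp_traj \<sigma> M' J') y (h q)"
    and q: "q \<in> pos_limit_set (imp_traj \<pi> M J) x" "q \<notin> M" and "t \<ge> 0"
  shows "h (imp_traj \<pi> M J q t) = imp_traj \<sigma> M' J' (h q) t"
proof -
  interpret X: standing_impulsive_system \<pi> M J by fact
  interpret Y: standing_impulsive_system \<sigma> M' J' by fact
  obtain u where u: "u \<in> lim_seqs_at X.\<tau> x q" using q(1) by (auto simp: pos_limit_set_def)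
  then have v: "u \<in> lim_seqs_at Y.\<tau> y (h q)" using h q(1) by blast
  have wX: "(\<lambda>n. X.\<tau> x (u n)) \<longlonglongrightarrow> q" and wY: "(\<lambda>n. Y.\<tau> y (u n)) \<longlonglongrightarrow> h q" and u0: "\<And>n. u n \<ge> 0"
    using u v by (auto simp: lim_seqs_at_def)
  \<comment> \<open>In \<open>X\<close> the analogous bound comes from \<open>q \<notin> M\<close>;
    here \<open>h q\<close> may lie in \<open>M'\<close>, and comparability has to exclude vanishing
    hitting times.\<close>
  have Yc: "\<exists>c>0. \<forall>\<^sub>F n in sequentially. ereal c \<le> Y.\<phi> (Y.\<tau> y (u n))"
  proof (rule ccontr)
    assume "\<not> ?thesis"
    from Y.vanishing_hit_times[OF wY this]
    obtain r s where r: "filterlim r at_top sequentially" and s: "\<And>n. Y.\<phi> (Y.\<tau> y (u (r n))) = ereal (s n)"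
      and s0: "s \<longlonglongrightarrow> 0" and l: "(\<lambda>n. \<sigma> (Y.\<tau> y (u (r n))) (s n)) \<longlonglongrightarrow> h q" and hM: "h q \<in> M'" by metis
    note s' = Y.hit_time_real[OF s]
    have "(\<lambda>n. J' (\<sigma> (Y.\<tau> y (u (r n))) (s n))) \<longlonglongrightarrow> J' (h q)"
      by (rule continuous_on_tendsto_compose[OF Y.impulse_continuous l hM]) (use s' in auto)
    \<comment> \<open>At the hitting time itself the trajectory already takes its post-impulse
      value.\<close>
    moreover have "J' (\<sigma> (Y.\<tau> y (u (r n))) (s n)) = Y.\<tau> y (u (r n) + s n)" for n
      using Y.imp_traj_after_hit[OF s[of n], of "s n"] s[of n] Y.imp_traj_add[of "u (r n)" "s n" y]
        u0 s'(1)[of n] Y.imp_traj_0 by simp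
    ultimately have "(\<lambda>n. Y.\<tau> y (u (r n) + s n)) \<longlonglongrightarrow> J' (h q)" by simp
    moreover have "(\<lambda>n. u (r n) + s n) \<in> lim_seqs_at X.\<tau> x q"
      using X.lim_seqs_at_shift[OF q(2) u r _ s0] s'(1) by (simp add: less_imp_le)
    then have "(\<lambda>n. Y.\<tau> y (u (r n) + s n)) \<longlonglongrightarrow> h q"
      using h[OF q(1)] by (auto simp: lim_seqs_at_def)
    ultimately have "J' (h q) = h q" using LIMSEQ_unique by blast
    then show False using Y.impulse_leaves hM by (metis disjoint_iff imageI)
  qed
  obtain e where e: "\<And>n. e n \<ge> 0" "e \<longlonglongrightarrow> 0"
    "\<And>s. s \<longlonglongrightarrow> t \<Longrightarrow> \<forall>\<^sub>F n in sequentially. t + e n \<le> s n \<Longrightarrow>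
      (\<lambda>n. X.\<tau> (X.\<tau> x (u n)) (s n)) \<longlonglongrightarrow> X.\<tau> q t"
    using X.imp_traj_tendsto[OF wX X.hit_time_bounded_below[OF wX q(2)] \<open>t \<ge> 0\<close>] by auto
  obtain d where d: "\<And>n. d n \<ge> 0" "d \<longlonglongrightarrow> 0"
    "\<And>s. s \<longlonglongrightarrow> t \<Longrightarrow> \<forall>\<^sub>F n in sequentially. t + d n \<le> s n \<Longrightarrow>
      (\<lambda>n. Y.\<tau> (Y.\<tau> y (u n)) (s n)) \<longlonglongrightarrow> Y.\<tau> (h q) t"
    using Y.imp_traj_tendsto[OF wY Yc \<open>t \<ge> 0\<close>] by auto
  \<comment> \<open>The sum dominates both delays, so the same times are admissible in both
    systems.\<close>
  define s where "s n = t + (e n + d n)" for n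
  have "s \<longlonglongrightarrow> t + (0 + 0)" unfolding s_def by (intro tendsto_intros e d)
  then have st: "s \<longlonglongrightarrow> t" by simp
  have s0: "s n \<ge> 0" for n using e(1)[of n] d(1)[of n] \<open>t \<ge> 0\<close> by (simp add: s_def)
  have "(\<lambda>n. X.\<tau> (X.\<tau> x (u n)) (s n)) \<longlonglongrightarrow> X.\<tau> q t" using e(3)[OF st] d(1) by (simp add: s_def)
  then have "(\<lambda>n. u n + s n) \<in> lim_seqs_at X.\<tau> x (X.\<tau> q t)" using X.lim_seqs_at_add u s0 by blast
  then have "(\<lambda>n. u n + s n) \<in> lim_seqs_at Y.\<tau> y (h (X.\<tau> q t))"
    using h X.pos_limit_set_invariant[OF q \<open>t \<ge> 0\<close>] by blast
  moreover have "(\<lambda>n. Y.\<tau> (Y.\<tau> y (u n)) (s n)) \<longlonglongrightarrow> Y.\<tau> (h q) t" using d(3)[OF st] e(1) by (simp add: s_def)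
  then have "(\<lambda>n. u n + s n) \<in> lim_seqs_at Y.\<tau> y (Y.\<tau> (h q) t)" using Y.lim_seqs_at_add v s0 by blast
  ultimately show ?thesis by (auto simp: lim_seqs_at_def intro: LIMSEQ_unique)
qed

section \<open>Condition (c) and the equivalence\<close>

theorem theorem4p17:
  fixes \<pi> :: "'a::metric_space \<Rightarrow> real \<Rightarrow> 'a" and M\<^sub>X :: "'a set" and I\<^sub>X :: "'a \<Rightarrow> 'a"
    and \<sigma> :: "'b::metric_space \<Rightarrow> real \<Rightarrow> 'b" and M\<^sub>Y :: "'b set" and I\<^sub>Y :: "'b \<Rightarrow> 'b"
    and x :: 'a and y :: 'b and g :: "'a \<Rightarrow> real \<Rightarrow> real"
  assumes "standing_impulsive_system \<pi> M\<^sub>X I\<^sub>X"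
    and "standing_impulsive_system \<sigma> M\<^sub>Y I\<^sub>Y"
    and "asymptotically_almost_periodic (imp_traj \<pi> M\<^sub>X I\<^sub>X) x"
    and "\<And>z. z \<in> reparam_points (imp_traj \<pi> M\<^sub>X I\<^sub>X) x \<Longrightarrow>
           asymptotic_reparam (imp_traj \<pi> M\<^sub>X I\<^sub>X) x z (g z)"
  shows "comparable_in_limit (imp_traj \<sigma> M\<^sub>Y I\<^sub>Y) y (imp_traj \<pi> M\<^sub>X I\<^sub>X) x \<longleftrightarrow>
    (\<exists>h. continuous_on (pos_limit_set (imp_traj \<pi> M\<^sub>X I\<^sub>X) x) h \<and>
         h ` pos_limit_set (imp_traj \<pi> M\<^sub>X I\<^sub>X) x \<subseteq> pos_limit_set (imp_traj \<sigma> M\<^sub>Y I\<^sub>Y) y \<and>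
         (\<forall>q \<in> pos_limit_set (imp_traj \<pi> M\<^sub>X I\<^sub>X) x.
            lim_seqs_at (imp_traj \<pi> M\<^sub>X I\<^sub>X) x q \<subseteq> lim_seqs_at (imp_traj \<sigma> M\<^sub>Y I\<^sub>Y) y (h q)) \<and>
         (\<forall>q \<in> pos_limit_set (imp_traj \<pi> M\<^sub>X I\<^sub>X) x - M\<^sub>X. \<forall>t\<ge>0.
            h (imp_traj \<pi> M\<^sub>X I\<^sub>X q t) = imp_traj \<sigma> M\<^sub>Y I\<^sub>Y (h q) t) \<and>
         (\<forall>q \<in> reparam_points (imp_traj \<pi> M\<^sub>X I\<^sub>X) x - M\<^sub>X.
            \<forall>t \<in> lim_seqs (imp_traj \<pi> M\<^sub>X I\<^sub>X) x.
            (\<lambda>n. dist (imp_traj \<sigma> M\<^sub>Y I\<^sub>Y y (t n)) (imp_traj \<sigma> M\<^sub>Y I\<^sub>Y (h q) (g q (t n))))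
              \<longlonglongrightarrow> 0))"
    (is "?comp \<longleftrightarrow> (\<exists>h. ?P h)")
proof
  interpret X: standing_impulsive_system \<pi> M\<^sub>X I\<^sub>X by fact
  assume ?comp
  then obtain h where cont: "continuous_on (pos_limit_set X.\<tau> x) h"
    and a: "\<And>q. q \<in> pos_limit_set X.\<tau> x \<Longrightarrow>
      lim_seqs_at X.\<tau> x q \<subseteq> lim_seqs_at (imp_traj \<sigma> M\<^sub>Y I\<^sub>Y) y (h q)"
    using comparable_in_limit_map by blast
  have range: "h ` pos_limit_set X.\<tau> x \<subseteq> pos_limit_set (imp_traj \<sigma> M\<^sub>Y I\<^sub>Y) y"
    using a by (force simp: pos_limit_set_def)
  note b = comparable_map_semiconjugates[OF assms(1,2) a]
  have "(\<lambda>n. dist (imp_traj \<sigma> M\<^sub>Y I\<^sub>Y y (t n)) (imp_traj \<sigma> M\<^sub>Y I\<^sub>Y (h q) (g q (t n)))) \<longlonglongrightarrow> 0"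
    if q: "q \<in> reparam_points X.\<tau> x" "q \<notin> M\<^sub>X" and t: "t \<in> lim_seqs X.\<tau> x" for q t
  proof -
    obtain p where p: "t \<in> lim_seqs_at X.\<tau> x p" using t by (auto simp: lim_seqs_def)
    then have pL: "p \<in> pos_limit_set X.\<tau> x" by (auto simp: pos_limit_set_def)
    have qL: "q \<in> pos_limit_set X.\<tau> x" using q(1) by (simp add: reparam_points_def)
    have t': "\<And>n. t n \<ge> 0" "filterlim t at_top sequentially" "(\<lambda>n. X.\<tau> x (t n)) \<longlonglongrightarrow> p"
      using p by (auto simp: lim_seqs_at_def)
    have g: "time_reparametrization (g q)"
      "((\<lambda>s. dist (X.\<tau> x s) (X.\<tau> q (g q s))) \<longlongrightarrow> 0) at_top"
      using assms(4)[OF q(1)] by (auto simp: asymptotic_reparam_def)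
    have g0: "g q (t n) \<ge> 0" for n
      using g(1) t'(1)[of n] unfolding time_reparametrization_def homeomorphism_def by fastforce
    have "(\<lambda>n. dist (X.\<tau> q (g q (t n))) (X.\<tau> x (t n))) \<longlonglongrightarrow> 0"
      using filterlim_compose[OF g(2) t'(2)] by (simp add: dist_commute)
    \<comment> \<open>The reparametrized orbit of \<open>q\<close> shares the limit \<open>p\<close>
      of \<open>x\<close> along \<open>t\<close>. It stays in the limit set, so continuity of
      \<open>h\<close> at \<open>p\<close> and the intertwining relation carry the convergence over
      to \<open>Y\<close>, where \<open>y\<close> has the same limit \<open>h p\<close>.\<close>
    then have "(\<lambda>n. X.\<tau> q (g q (t n))) \<longlonglongrightarrow> p" using t'(3) by (rule tendsto_dist_transform)
    then have "(\<lambda>n. h (X.\<tau> q (g q (t n)))) \<longlonglongrightarrow> h p"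
      by (rule continuous_on_tendsto_compose[OF cont _ pL])
        (use X.pos_limit_set_invariant[OF qL q(2) g0] in auto)
    then have "(\<lambda>n. imp_traj \<sigma> M\<^sub>Y I\<^sub>Y (h q) (g q (t n))) \<longlonglongrightarrow> h p"
      using b[OF _ qL q(2) g0] by simp
    moreover have "(\<lambda>n. imp_traj \<sigma> M\<^sub>Y I\<^sub>Y y (t n)) \<longlonglongrightarrow> h p"
      using a[OF pL] p by (auto simp: lim_seqs_at_def)
    ultimately show ?thesis using tendsto_dist by fastforce
  qed
  then have "?P h" using cont range a b by auto
  then show "\<exists>h. ?P h" by blast
next
  assume "\<exists>h. ?P h"
  \<comment> \<open>The limit of \<open>x\<close> along a given sequence lies in the limit set, so
    (a) applies at that point and provides a limit for \<open>y\<close>.\<close>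
  then show ?comp
    by (fastforce simp: comparable_in_limit_def lim_seqs_def pos_limit_set_def)
qed

end
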